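(* Let $G$ be a finitely generated group with a finite generating set $A$, and let $\psi : L \rightarrow G$, $L\subseteq\Sigma^*$, be a Cayley p.f. linear-time computable representation of $G$. Then $\psi$ has quasigeodesic normal form, that is, there is a constant $C$ such that for all $w \in L$: $|w| \leqslant C\left(d_A(\psi(w))+1\right)$.
   Context: Position-faithful one-tape Turing machine: a Turing machine with one semi-infinite tape (infinite in one direction only) whose left-most cell contains a special symbol $\boxplus$ which occurs only there and cannot be modified. On input $x\in\Sigma^*$ the initial tape content is $\boxplus x\boxdot^\infty$, where $\boxdot$ is a special blank symbol and $\Sigma\cap\{\boxplus,\boxdot\}=\varnothing$, and the head starts at $\boxplus$. The machine computes $f:\Sigma^*\to\Sigma^*$ if on every input $x\in\Sigma^*$ it eventually reaches an accepting state and halts with the tape having prefix $\boxplus f(x)\boxdot$ (no restriction on the tape content after this first $\boxdot$). A function $f:\Sigma^*\to\Sigma^*$ is position-faithful (p.f.) linear-time computable if it is computed by a deterministic position-faithful one-tape Turing machine in time linear in the input length. Let $G$ be a finitely generated group and $S=\{s_1,\dots,s_n\}\subset G$ a finite set of semigroup generators (every $g\in G$ is a product of elements of $S$). A Cayley p.f. linear-time computable representation of $G$ is a bijection $\psi:L\to G$, where $L\subseteq\Sigma^*$ is a language over a finite alphabet $\Sigma$, for which there exist p.f. linear-time computable functions $f_i:\Sigma^*\to\Sigma^*$, $i=1,\dots,n$, with $f_i(L)\subseteq L$ and $\psi(f_i(w))=\psi(w)s_i$ for all $w\in L$. Here $S=A\cup A^{-1}$, where $A$ is a finite generating set of $G$.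 For $g\in G$, $d_A(g)$ is the length of a shortest word over $A\cup A^{-1}$ representing $g$; $|w|$ is the length of the string $w$. *)

theory Defs
  imports Complex_Main "HOL-Algebra.Generated_Groups"
begin

text \<open>
  The constructors keep the two special symbols apart from the letters of the alphabet;
  \<open>Aux\<close> supplies the further work symbols a machine may use.
\<close>

datatype 'a tape_symbol = LeftEnd | Blank | Letter 'a | Aux nat

datatype move = MoveLeft | Stay | MoveRight

record 'a tm =
  states :: "nat set"
  tape_alphabet :: "'a tape_symbol set"
  start_state :: nat
  accepting :: "nat set"
  trans_fun :: "nat \<Rightarrow> 'a tape_symbol \<Rightarrow> (nat \<times> 'a tape_symbol \<times> move) option"

text \<open>
  The last conjunct says that a machine always rewrites the left-end marker by itself, never
  leaves the tape to the left, and writes no left-end marker anywhere else. An undefined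
  transition means that the machine halts.
\<close>

definition pf_tm :: "'a set \<Rightarrow> 'a tm \<Rightarrow> bool" where
  "pf_tm \<Sigma> M \<longleftrightarrow>
     finite (states M) \<and> finite (tape_alphabet M) \<and>
     {LeftEnd, Blank} \<union> Letter ` \<Sigma> \<subseteq> tape_alphabet M \<and>
     start_state M \<in> states M \<and> accepting M \<subseteq> states M \<and>
     (\<forall>q\<in>states M. \<forall>a\<in>tape_alphabet M. \<forall>q' b m. trans_fun M q a = Some (q', b, m) \<longrightarrow>
        q' \<in> states M \<and> b \<in> tape_alphabet M \<and>
        (b = LeftEnd \<longleftrightarrow> a = LeftEnd) \<and> (a = LeftEnd \<longrightarrow> m \<noteq> MoveLeft))"

text \<open>A configuration consists of the state, the tape (cell 0 is left-most) and the head position.\<close>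

type_synonym 'a config = "nat \<times> (nat \<Rightarrow> 'a tape_symbol) \<times> nat"

definition initial_tape :: "'a list \<Rightarrow> nat \<Rightarrow> 'a tape_symbol" where
  "initial_tape x i =
     (if i = 0 then LeftEnd else if i \<le> length x then Letter (x ! (i - 1)) else Blank)"

definition initial_config :: "'a tm \<Rightarrow> 'a list \<Rightarrow> 'a config" where
  "initial_config M x = (start_state M, initial_tape x, 0)"

fun move_head :: "move \<Rightarrow> nat \<Rightarrow> nat" where
  "move_head MoveLeft h = h - 1"
| "move_head Stay h = h"
| "move_head MoveRight h = h + 1"

text \<open>Halted configurations are fixed points of \<open>tm_step\<close>.\<close>

fun tm_step :: "'a tm \<Rightarrow> 'a config \<Rightarrow> 'a config" where
  "tm_step M (q, tape, h) =
     (case trans_fun M q (tape h) of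
        None \<Rightarrow> (q, tape, h)
      | Some (q', b, m) \<Rightarrow> (q', tape(h := b), move_head m h))"

fun halted_accepting :: "'a tm \<Rightarrow> 'a config \<Rightarrow> bool" where
  "halted_accepting M (q, tape, h) \<longleftrightarrow> trans_fun M q (tape h) = None \<and> q \<in> accepting M"

text \<open>The cells after the first blank following the output are unconstrained.\<close>

fun has_output :: "'a config \<Rightarrow> 'a list \<Rightarrow> bool" where
  "has_output (q, tape, h) y \<longleftrightarrow>
     tape 0 = LeftEnd \<and> (\<forall>i<length y. tape (i + 1) = Letter (y ! i)) \<and>
     tape (length y + 1) = Blank"

definition computes_within ::
    "'a set \<Rightarrow> 'a tm \<Rightarrow> ('a list \<Rightarrow> 'a list) \<Rightarrow> (nat \<Rightarrow> nat) \<Rightarrow> bool" where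
  "computes_within \<Sigma> M f T \<longleftrightarrow>
     (\<forall>x\<in>lists \<Sigma>. \<exists>t\<le>T (length x). \<exists>c. c = (tm_step M ^^ t) (initial_config M x) \<and>
        halted_accepting M c \<and> has_output c (f x))"

text \<open>
  Functions on words over \<open>\<Sigma>\<close> are represented by functions on lists, of which only the
  restriction to \<open>lists \<Sigma>\<close> matters. The additive constant in the time bound is needed
  for the empty input.
\<close>

definition pf_linear_time_computable :: "'a set \<Rightarrow> ('a list \<Rightarrow> 'a list) \<Rightarrow> bool" where
  "pf_linear_time_computable \<Sigma> f \<longleftrightarrow>
     f ` lists \<Sigma> \<subseteq> lists \<Sigma> \<and>
     (\<exists>M k. pf_tm \<Sigma> M \<and> computes_within \<Sigma> M f (\<lambda>n. k * n + k))"

definition (in group) semigroup_generators :: "'a set \<Rightarrow> bool" where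
  "semigroup_generators S \<longleftrightarrow>
     S \<subseteq> carrier G \<and> (\<forall>g\<in>carrier G. \<exists>ws\<in>lists S. g = foldr (\<otimes>) ws \<one>)"

text \<open>\<open>\<psi>\<close> matters only on \<open>L\<close>.\<close>

definition (in group) cayley_pf_linear_time_representation ::
    "'a set \<Rightarrow> 'c set \<Rightarrow> 'c list set \<Rightarrow> ('c list \<Rightarrow> 'a) \<Rightarrow> bool" where
  "cayley_pf_linear_time_representation S \<Sigma> L \<psi> \<longleftrightarrow>
     finite S \<and> semigroup_generators S \<and>
     finite \<Sigma> \<and> L \<subseteq> lists \<Sigma> \<and> bij_betw \<psi> L (carrier G) \<and>
     (\<forall>s\<in>S. \<exists>f. pf_linear_time_computable \<Sigma> f \<and> f ` L \<subseteq> L \<and> (\<forall>w\<in>L. \<psi> (f w) = \<psi> w \<otimes> s))"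

definition (in group) word_length :: "'a set \<Rightarrow> 'a \<Rightarrow> nat" where
  "word_length A g =
     (LEAST n. \<exists>ws\<in>lists (A \<union> m_inv G ` A). length ws = n \<and> foldr (\<otimes>) ws \<one> = g)"

definition (in group) quasigeodesic_normal_form ::
    "'a set \<Rightarrow> 'c list set \<Rightarrow> ('c list \<Rightarrow> 'a) \<Rightarrow> bool" where
  "quasigeodesic_normal_form A L \<psi> \<longleftrightarrow>
     (\<exists>C::real. \<forall>w\<in>L. real (length w) \<le> C * (real (word_length A (\<psi> w)) + 1))"

end

theory Submission
  imports Defs
begin

text \<open>
  The heart of the matter is that a function computed in linear time by a position-faithful
  one-tape machine lengthens its argument by at most an additive constant
  (\<open>linear_time_length_increase\<close>). The obvious bound, that the output is no longer than the
  running time, is useless here: it is multiplicative and grows exponentially when generators are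
  applied one after the other. With an additive constant \<open>C\<^sub>0\<close> that serves
  all of the finitely many generators, walking from the identity to \<open>\<psi> w\<close> along a geodesic adds
  at most \<open>C\<^sub>0\<close> letters per generator, which gives the theorem.

  The additive bound comes from crossing sequences. The crossing sequence at boundary \<open>p\<close> is the
  list of states in which the head passes between the cells \<open>p\<close> and \<open>p + 1\<close>; it is all that the
  two sides of the boundary learn of each other. Hence, if the crossing sequences at two
  boundaries \<open>p < q\<close> of an input \<open>x\<close> agree, the letters between them may be cut out: the run on
  the shortened input ends with the final tape for \<open>x\<close> from which the same segment has been cut
  out (\<open>splice_final_tape\<close>). When the output reaches beyond the input, both therefore lose
  \<open>q - p\<close> letters, and the difference of their lengths is unchanged.

  Every step crosses at most one boundary, so in time \<open>k * (n + 1)\<close> the \<open>n + 1\<close> boundaries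
  \<open>0, \<dots>, n\<close> of an input of length \<open>n\<close> have crossing sequences of average length at most \<open>k\<close>.
  There are only finitely many crossing sequences of length at most \<open>2 * k\<close>, so on a long input
  two boundaries must agree (\<open>equal_crossings_exist\<close>). Repeated cutting reduces every
  input that is shorter than its output to one of finitely many short ones.
\<close>

section \<open>Runs and crossing sequences\<close>

definition run :: "'a tm \<Rightarrow> 'a list \<Rightarrow> nat \<Rightarrow> 'a config" where
  "run M x t = (tm_step M ^^ t) (initial_config M x)"

abbreviation state_at :: "'a tm \<Rightarrow> 'a list \<Rightarrow> nat \<Rightarrow> nat" where
  "state_at M x t \<equiv> fst (run M x t)"

abbreviation tape_at :: "'a tm \<Rightarrow> 'a list \<Rightarrow> nat \<Rightarrow> nat \<Rightarrow> 'a tape_symbol" where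
  "tape_at M x t \<equiv> fst (snd (run M x t))"

abbreviation head_at :: "'a tm \<Rightarrow> 'a list \<Rightarrow> nat \<Rightarrow> nat" where
  "head_at M x t \<equiv> snd (snd (run M x t))"

abbreviation action_at ::
    "'a tm \<Rightarrow> 'a list \<Rightarrow> nat \<Rightarrow> (nat \<times> 'a tape_symbol \<times> move) option" where
  "action_at M x t \<equiv> trans_fun M (state_at M x t) (tape_at M x t (head_at M x t))"

primrec crossing_sequence :: "'a tm \<Rightarrow> 'a list \<Rightarrow> nat \<Rightarrow> nat \<Rightarrow> nat list" where
  "crossing_sequence M x p 0 = []"
| "crossing_sequence M x p (Suc t) = crossing_sequence M x p t @
     (if (head_at M x t \<le> p) = (head_at M x (Suc t) \<le> p) then [] else [state_at M x (Suc t)])"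

lemma run_0: "run M x 0 = (start_state M, initial_tape x, 0)"
  by (simp add: run_def initial_config_def)

lemma run_Suc:
  "run M x (Suc t) =
     (case action_at M x t of
        None \<Rightarrow> run M x t
      | Some (q, b, m) \<Rightarrow> (q, (tape_at M x t)(head_at M x t := b), move_head m (head_at M x t)))"
proof -
  obtain q tp h where "run M x t = (q, tp, h)" by (cases "run M x t") auto
  then show ?thesis by (simp add: run_def split: option.splits)
qed

lemma move_head_bounds: "h \<le> Suc (move_head m h)" "move_head m h \<le> Suc h"
  by (cases m; simp)+

lemma head_at_Suc_bounds:
  "head_at M x t \<le> Suc (head_at M x (Suc t))" "head_at M x (Suc t) \<le> Suc (head_at M x t)"
  by (simp_all add: run_Suc move_head_bounds split: option.splits prod.splits)

lemma tape_at_Suc_other: "i \<noteq> head_at M x t \<Longrightarrow> tape_at M x (Suc t) i = tape_at M x t i"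
  by (simp add: run_Suc split: option.splits prod.splits)

lemma run_after_halt:
  assumes "action_at M x t = None" and "t \<le> u"
  shows "run M x u = run M x t"
  using assms(2) by (induction u rule: dec_induct) (simp_all add: run_Suc assms(1))

lemma run_halted_unique:
  assumes "action_at M x t = None" and "action_at M x u = None"
  shows "run M x t = run M x u"
  using run_after_halt[OF assms(1), of u] run_after_halt[OF assms(2), of t] by (metis nat_le_linear)

text \<open>
  The head starts to the left of every boundary and changes sides at each crossing; the parity of
  the number of crossings therefore tells which of the two sides is active.
\<close>

lemma head_side_parity: "p < head_at M x t \<longleftrightarrow> odd (length (crossing_sequence M x p t))"
  by (induction t) (auto simp: run_0 not_less)

lemma crossing_sequence_extends:
  "t \<le> u \<Longrightarrow> \<exists>zs. crossing_sequence M x p u = crossing_sequence M x p t @ zs"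
  by (induction u rule: dec_induct) auto

lemma crossing_sequence_length_mono:
  "t \<le> u \<Longrightarrow> length (crossing_sequence M x p t) \<le> length (crossing_sequence M x p u)"
  using crossing_sequence_extends[of t u M x p] by auto

lemma crossing_sequence_after_halt:
  assumes "action_at M x t = None" and "t \<le> u"
  shows "crossing_sequence M x p u = crossing_sequence M x p t"
  using assms(2)
proof (induction u rule: dec_induct)
  case (step u)
  then show ?case
    using run_after_halt[OF assms(1), of u] run_after_halt[OF assms(1), of "Suc u"] by simp
qed simp

lemma crossing_sequence_halted_extends:
  assumes "action_at M x t = None"
  shows "\<exists>zs. crossing_sequence M x p t = crossing_sequence M x p u @ zs"
  using crossing_sequence_extends[of u t M x p] crossing_sequence_after_halt[OF assms, of u p]
  by (metis append_Nil2 nat_le_linear)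

text \<open>Between two crossings of a boundary, only the side that contains the head can change.\<close>

lemma passive_side_unchanged_le:
  assumes "t \<le> u" and "length (crossing_sequence M x p t) = length (crossing_sequence M x p u)"
    and "p < i \<longleftrightarrow> even (length (crossing_sequence M x p t))"
  shows "tape_at M x u i = tape_at M x t i"
  using assms
proof (induction u rule: dec_induct)
  case (step u)
  have len: "length (crossing_sequence M x p u) = length (crossing_sequence M x p t)"
    using crossing_sequence_length_mono[OF step.hyps(1), of M x p] step.prems(1)
    by (simp split: if_splits)
  then have "i \<noteq> head_at M x u"
    using step.prems(2) head_side_parity[of p M x u] by auto
  then show ?case
    using step.IH[OF len[symmetric] step.prems(2)] tape_at_Suc_other by metis
qed simp

lemma passive_side_unchanged:
  assumes "length (crossing_sequence M x p t) = length (crossing_sequence M x p u)"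
    and "p < i \<longleftrightarrow> even (length (crossing_sequence M x p t))"
  shows "tape_at M x u i = tape_at M x t i"
  using passive_side_unchanged_le[of t u M x p i] passive_side_unchanged_le[of u t M x p i] assms
  by (metis nat_le_linear)

lemma next_crossing:
  assumes "length (crossing_sequence M x p t) < length (crossing_sequence M x p u)"
  obtains v where "crossing_sequence M x p v = crossing_sequence M x p t"
    and "crossing_sequence M x p (Suc v) = crossing_sequence M x p t @ [state_at M x (Suc v)]"
  using assms
proof (induction u arbitrary: thesis)
  case (Suc u)
  show ?case
  proof (cases "length (crossing_sequence M x p t) < length (crossing_sequence M x p u)")
    case True
    then show ?thesis using Suc.IH Suc.prems(1) by blast
  next
    case False
    have "t \<le> u"
      using Suc.prems(2) crossing_sequence_length_mono[of "Suc u" t M x p] by (meson not_less not_less_eq_eq)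
    then obtain zs where "crossing_sequence M x p u = crossing_sequence M x p t @ zs"
      using crossing_sequence_extends by blast
    then have "crossing_sequence M x p u = crossing_sequence M x p t" using False by simp
    then show ?thesis using Suc.prems by (intro Suc.prems(1)[of u]) (auto split: if_splits)
  qed
qed simp

text \<open>A crossing moves the head between the two cells next to the boundary.\<close>

lemma head_at_crossing:
  assumes "length (crossing_sequence M x p v) < length (crossing_sequence M x p (Suc v))"
  shows "head_at M x (Suc v) = (if even (length (crossing_sequence M x p v)) then Suc p else p)"
  using assms head_side_parity[of p M x v] head_at_Suc_bounds[of M x v]
  by (auto split: if_splits)

section \<open>Splicing two runs\<close>

text \<open>
  The configuration \<open>c\<close> arises from time \<open>a\<close> of the run on \<open>x\<close> left of boundary \<open>p\<close> and
  time \<open>b\<close> of the run on \<open>y\<close> right of boundary \<open>q\<close>. The two times differ in general, but the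
  two boundaries have been crossed equally often, so that both heads are on the same side; the run
  owning that side supplies state and head. The subtraction-free form of the last equation says
  that the head in \<open>c\<close> is as far to the right of \<open>p\<close> as the head in the run on \<open>y\<close> is of \<open>q\<close>.
\<close>

definition spliced ::
    "'a tm \<Rightarrow> 'a list \<Rightarrow> nat \<Rightarrow> 'a list \<Rightarrow> nat \<Rightarrow> 'a config \<Rightarrow> nat \<Rightarrow> nat \<Rightarrow> bool" where
  "spliced M x p y q c a b \<longleftrightarrow>
     length (crossing_sequence M x p a) = length (crossing_sequence M y q b) \<and>
     (\<forall>i\<le>p. fst (snd c) i = tape_at M x a i) \<and>
     (\<forall>i. fst (snd c) (p + Suc i) = tape_at M y b (q + Suc i)) \<and>
     (if even (length (crossing_sequence M x p a))
      then fst c = state_at M x a \<and> snd (snd c) = head_at M x a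
      else fst c = state_at M y b \<and> snd (snd c) + q = head_at M y b + p)"

lemma spliced_initial:
  assumes "p \<le> length x" and "q \<le> length y"
  shows "spliced M x p y q (run M (take p x @ drop q y) 0) 0 0"
  using assms by (auto simp: spliced_def run_0 initial_tape_def nth_append min_def)

text \<open>
  While the active run stays on its side, only its clock advances. When it crosses, control passes
  to the other run, whose clock is put forward to its own next crossing: as the crossing sequences
  agree, that crossing takes place, and in the same state.
\<close>

lemma spliced_step:
  assumes sp: "spliced M x p y q (run M z t) a b"
    and halt: "action_at M x tx = None" "action_at M y ty = None"
    and eq: "crossing_sequence M x p tx = crossing_sequence M y q ty"
  shows "\<exists>a b. spliced M x p y q (run M z (Suc t)) a b"
proof -
  note len = sp[unfolded spliced_def, THEN conjunct1]
  have left: "\<And>i. i \<le> p \<Longrightarrow> tape_at M z t i = tape_at M x a i"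
    and right: "\<And>i. tape_at M z t (p + Suc i) = tape_at M y b (q + Suc i)"
    using sp by (auto simp: spliced_def)
  obtain zx where zx: "crossing_sequence M x p tx = crossing_sequence M x p a @ zx"
    using crossing_sequence_halted_extends[OF halt(1)] by blast
  obtain zy where zy: "crossing_sequence M y q ty = crossing_sequence M y q b @ zy"
    using crossing_sequence_halted_extends[OF halt(2)] by blast
  have cs: "crossing_sequence M x p a = crossing_sequence M y q b"
    using zx zy eq len by simp
  show ?thesis
  proof (cases "even (length (crossing_sequence M x p a))")
    case True
    have st: "state_at M z t = state_at M x a" and hd: "head_at M z t = head_at M x a"
      using sp True by (auto simp: spliced_def)
    have hp: "head_at M x a \<le> p" using head_side_parity[of p M x a] True by simp
    have act: "action_at M z t = action_at M x a" using st hd left[OF hp] by simp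
    have st': "state_at M z (Suc t) = state_at M x (Suc a)"
      and hd': "head_at M z (Suc t) = head_at M x (Suc a)"
      using act st hd by (simp_all add: run_Suc split: option.splits prod.splits)
    have left': "tape_at M z (Suc t) i = tape_at M x (Suc a) i" if "i \<le> p" for i
      using act hd left[OF that] by (simp add: run_Suc split: option.splits prod.splits)
    have right': "tape_at M z (Suc t) (p + Suc i) = tape_at M y b (q + Suc i)" for i
      using right[of i] hp hd by (subst tape_at_Suc_other) auto
    show ?thesis
    proof (cases "crossing_sequence M x p (Suc a) = crossing_sequence M x p a")
      case same: True
      have "spliced M x p y q (run M z (Suc t)) (Suc a) b"
        unfolding spliced_def using True same len st' hd' left' right' by (simp del: crossing_sequence.simps)
      then show ?thesis by blast
    next
      case False
      then have crossed:
        "crossing_sequence M x p (Suc a) = crossing_sequence M x p a @ [state_at M x (Suc a)]"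
        by (auto split: if_splits)
      obtain zs where zs: "crossing_sequence M y q ty = crossing_sequence M x p (Suc a) @ zs"
        using crossing_sequence_halted_extends[OF halt(1), of p "Suc a"] eq by auto
      have "length (crossing_sequence M y q b) < length (crossing_sequence M y q ty)"
        unfolding zs crossed cs by simp
      then obtain v where v: "crossing_sequence M y q v = crossing_sequence M y q b"
        "crossing_sequence M y q (Suc v) = crossing_sequence M y q b @ [state_at M y (Suc v)]"
        by (rule next_crossing)
      obtain zs' where zs': "crossing_sequence M y q ty = crossing_sequence M y q (Suc v) @ zs'"
        using crossing_sequence_halted_extends[OF halt(2)] by blast
      have same_state: "state_at M x (Suc a) = state_at M y (Suc v)"
        using zs zs' unfolding crossed v(2) cs by simp
      have hx: "head_at M x (Suc a) = Suc p"
        using head_at_crossing[of M x p a] crossed True by (simp del: crossing_sequence.simps)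
      have hy: "head_at M y (Suc v) = Suc q"
        using head_at_crossing[of M y q v] v True cs by (simp del: crossing_sequence.simps)
      have hv: "head_at M y v \<le> q" using head_side_parity[of q M y v] v(1) cs True by simp
      have "tape_at M y (Suc v) (q + Suc i) = tape_at M y b (q + Suc i)" for i
        using passive_side_unchanged[of M y q b v "q + Suc i"] v(1) True cs hv
        by (subst tape_at_Suc_other) auto
      then have "spliced M x p y q (run M z (Suc t)) (Suc a) (Suc v)"
        unfolding spliced_def crossed v(2) using True cs st' hd' left' right' same_state hx hy by simp
      then show ?thesis by blast
    qed
  next
    case False
    have st: "state_at M z t = state_at M y b" and hd: "head_at M z t + q = head_at M y b + p"
      using sp False by (auto simp: spliced_def)
    have hq: "q < head_at M y b" using head_side_parity[of q M y b] False cs by simp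
    then obtain j where j: "head_at M y b = q + Suc j"
      by (metis less_imp_Suc_add add_Suc_right)
    then have hz: "head_at M z t = p + Suc j" using hd by simp
    have act: "action_at M z t = action_at M y b" using st j hz right[of j] by simp
    have st': "state_at M z (Suc t) = state_at M y (Suc b)"
      using act st by (simp add: run_Suc split: option.splits prod.splits)
    have "move_head m (p + Suc j) + q = move_head m (q + Suc j) + p" for m
      by (cases m) auto
    then have hd': "head_at M z (Suc t) + q = head_at M y (Suc b) + p"
      using act j hz by (simp add: run_Suc split: option.splits prod.splits)
    have right': "tape_at M z (Suc t) (p + Suc i) = tape_at M y (Suc b) (q + Suc i)" for i
      using act j hz right[of i] by (simp add: run_Suc split: option.splits prod.splits)
    have left': "tape_at M z (Suc t) i = tape_at M x a i" if "i \<le> p" for i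
      using left[OF that] hz that by (subst tape_at_Suc_other) auto
    show ?thesis
    proof (cases "crossing_sequence M y q (Suc b) = crossing_sequence M y q b")
      case same: True
      have "spliced M x p y q (run M z (Suc t)) a (Suc b)"
        unfolding spliced_def using False same len st' hd' left' right' by (simp del: crossing_sequence.simps)
      then show ?thesis by blast
    next
      case changed: False
      then have crossed:
        "crossing_sequence M y q (Suc b) = crossing_sequence M y q b @ [state_at M y (Suc b)]"
        by (auto split: if_splits)
      obtain zs where zs: "crossing_sequence M x p tx = crossing_sequence M y q (Suc b) @ zs"
        using crossing_sequence_halted_extends[OF halt(2), of q "Suc b"] eq by auto
      have "length (crossing_sequence M x p a) < length (crossing_sequence M x p tx)"
        unfolding zs crossed cs by simp
      then obtain v where v: "crossing_sequence M x p v = crossing_sequence M x p a"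
        "crossing_sequence M x p (Suc v) = crossing_sequence M x p a @ [state_at M x (Suc v)]"
        by (rule next_crossing)
      obtain zs' where zs': "crossing_sequence M x p tx = crossing_sequence M x p (Suc v) @ zs'"
        using crossing_sequence_halted_extends[OF halt(1)] by blast
      have same_state: "state_at M y (Suc b) = state_at M x (Suc v)"
        using zs zs' unfolding crossed v(2) cs by simp
      have hy: "head_at M y (Suc b) = q"
        using head_at_crossing[of M y q b] crossed False cs by (simp del: crossing_sequence.simps)
      have hx: "head_at M x (Suc v) = p"
        using head_at_crossing[of M x p v] v False by (simp del: crossing_sequence.simps)
      have hv: "p < head_at M x v" using head_side_parity[of p M x v] v(1) False by simp
      have "tape_at M x (Suc v) i = tape_at M x a i" if "i \<le> p" for i
        using passive_side_unchanged[of M x p a v i] v(1) False hv that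
        by (subst tape_at_Suc_other) auto
      then have "spliced M x p y q (run M z (Suc t)) (Suc v) (Suc b)"
        unfolding spliced_def crossed v(2) using False cs st' hd' left' right' same_state hx hy by simp
      then show ?thesis by blast
    qed
  qed
qed

text \<open>
  When the spliced run halts, the run that owns the active side has halted as well. So it has
  made all of its crossings, hence so has the other run, whose passive side is final too.
\<close>

lemma splice_final_tape:
  assumes "p \<le> length x" and "q \<le> length y"
    and halt: "action_at M x tx = None" "action_at M y ty = None"
    and eq: "crossing_sequence M x p tx = crossing_sequence M y q ty"
    and haltz: "action_at M (take p x @ drop q y) tz = None"
  shows "\<And>i. i \<le> p \<Longrightarrow> tape_at M (take p x @ drop q y) tz i = tape_at M x tx i"
    and "\<And>i. tape_at M (take p x @ drop q y) tz (p + Suc i) = tape_at M y ty (q + Suc i)"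
proof -
  let ?z = "take p x @ drop q y"
  have "\<exists>a b. spliced M x p y q (run M ?z t) a b" for t
  proof (induction t)
    case 0
    show ?case using spliced_initial[OF assms(1,2)] by blast
  next
    case (Suc t)
    then show ?case using spliced_step[OF _ halt eq] by blast
  qed
  then obtain a b where sp: "spliced M x p y q (run M ?z tz) a b" by blast
  have len: "length (crossing_sequence M x p a) = length (crossing_sequence M y q b)"
    and left: "\<And>i. i \<le> p \<Longrightarrow> tape_at M ?z tz i = tape_at M x a i"
    and right: "\<And>i. tape_at M ?z tz (p + Suc i) = tape_at M y b (q + Suc i)"
    using sp by (auto simp: spliced_def)
  have "(\<forall>i\<le>p. tape_at M x a i = tape_at M x tx i) \<and>
        (\<forall>i. tape_at M y b (q + Suc i) = tape_at M y ty (q + Suc i))"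
  proof (cases "even (length (crossing_sequence M x p a))")
    case True
    have "head_at M x a \<le> p" using head_side_parity[of p M x a] True by simp
    then have hx: "action_at M x a = None"
      using sp True haltz left by (auto simp: spliced_def)
    have "crossing_sequence M x p a = crossing_sequence M x p tx"
      using crossing_sequence_after_halt[OF hx, of tx p]
        crossing_sequence_after_halt[OF halt(1), of a p] by (metis nat_le_linear)
    then show ?thesis
      using run_halted_unique[OF hx halt(1)] passive_side_unchanged[of M y q b ty] len eq True
      by auto
  next
    case False
    have "q < head_at M y b" using head_side_parity[of q M y b] False len by simp
    then obtain j where j: "head_at M y b = q + Suc j"
      by (metis less_imp_Suc_add add_Suc_right)
    then have "head_at M ?z tz = p + Suc j" using sp False by (auto simp: spliced_def)
    then have hy: "action_at M y b = None"
      using sp False haltz right[of j] j by (auto simp: spliced_def)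
    have "crossing_sequence M y q b = crossing_sequence M y q ty"
      using crossing_sequence_after_halt[OF hy, of ty q]
        crossing_sequence_after_halt[OF halt(2), of b q] by (metis nat_le_linear)
    then show ?thesis
      using run_halted_unique[OF hy halt(2)] passive_side_unchanged[of M x p a tx] len eq False
      by auto
  qed
  then show "\<And>i. i \<le> p \<Longrightarrow> tape_at M ?z tz i = tape_at M x tx i"
    and "\<And>i. tape_at M ?z tz (p + Suc i) = tape_at M y ty (q + Suc i)"
    using left right by auto
qed

section \<open>Equal crossing sequences on long inputs\<close>

lemma total_crossings_le_time: "(\<Sum>p<m. length (crossing_sequence M x p t)) \<le> t"
proof (induction t)
  case (Suc t)
  let ?h = "head_at M x t" and ?h' = "head_at M x (Suc t)"
  have "(\<Sum>p<m. length (crossing_sequence M x p (Suc t))) \<le>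
      (\<Sum>p<m. length (crossing_sequence M x p t) + (if p = min ?h ?h' then 1 else 0))"
    using head_at_Suc_bounds[of M x t] by (intro sum_mono) (auto simp: min_def)
  also have "\<dots> \<le> t + 1" using Suc by (simp add: sum.distrib)
  finally show ?case by simp
qed simp

lemma run_in_machine:
  assumes "pf_tm \<Sigma> M" and "x \<in> lists \<Sigma>"
  shows "state_at M x t \<in> states M \<and> (\<forall>i. tape_at M x t i \<in> tape_alphabet M)"
proof -
  note machine = assms(1)[unfolded pf_tm_def]
  have start: "start_state M \<in> states M" using machine by (elim conjE)
  have symbols: "{LeftEnd, Blank} \<union> Letter ` \<Sigma> \<subseteq> tape_alphabet M"
    using machine by (elim conjE)
  have trans: "q' \<in> states M \<and> b \<in> tape_alphabet M"
    if "q \<in> states M" "a \<in> tape_alphabet M" "trans_fun M q a = Some (q', b, m)" for q a q' b m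
    using machine[THEN conjunct2, THEN conjunct2, THEN conjunct2, THEN conjunct2, THEN conjunct2,
        rule_format, OF that] by (elim conjE) (rule conjI)
  show ?thesis
  proof (induction t)
    case 0
    have "x ! i \<in> \<Sigma>" if "i < length x" for i using assms(2) that by auto
    then show ?case using start symbols by (auto simp: run_0 initial_tape_def)
  next
    case (Suc t)
    show ?case
    proof (cases "action_at M x t")
      case None
      then show ?thesis using Suc by (simp add: run_Suc)
    next
      case (Some r)
      obtain q b m where r: "r = (q, b, m)" by (cases r)
      have "q \<in> states M \<and> b \<in> tape_alphabet M"
        using trans[of "state_at M x t" "tape_at M x t (head_at M x t)" q b m]
          Suc Some r by simp
      then show ?thesis using Suc Some r by (simp add: run_Suc)
    qed
  qed
qed

lemma crossing_sequence_states:
  assumes "pf_tm \<Sigma> M" and "x \<in> lists \<Sigma>"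
  shows "set (crossing_sequence M x p t) \<subseteq> states M"
  using run_in_machine[OF assms] by (induction t) auto

text \<open>
  Markov's inequality and the pigeonhole principle: at most half of the boundaries can have
  crossing sequences longer than twice the average, and if the sequences were distinct, only a
  bounded number of boundaries could have the remaining, short ones.
\<close>

lemma equal_crossings_exist:
  assumes "pf_tm \<Sigma> M"
  obtains N where "\<And>x t. x \<in> lists \<Sigma> \<Longrightarrow> N \<le> length x \<Longrightarrow> t \<le> k * length x + k \<Longrightarrow>
    \<exists>p q. p < q \<and> q \<le> length x \<and> crossing_sequence M x p t = crossing_sequence M x q t"
proof -
  define W where "W = {ws. set ws \<subseteq> states M \<and> length ws \<le> 2 * k}"
  have finW: "finite W"
    unfolding W_def using assms by (intro finite_lists_length_le) (simp add: pf_tm_def)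
  have "\<exists>p q. p < q \<and> q \<le> length x \<and> crossing_sequence M x p t = crossing_sequence M x q t"
    if x: "x \<in> lists \<Sigma>" and long: "(2 * k + 1) * card W \<le> length x"
      and t: "t \<le> k * length x + k" for x t
  proof (rule ccontr)
    assume none: "\<not> ?thesis"
    let ?cs = "\<lambda>p. crossing_sequence M x p t"
    let ?n = "Suc (length x)"
    have inj: "inj_on ?cs {..<?n}"
    proof (rule linorder_inj_onI)
      show "?cs p \<noteq> ?cs q" if "p < q" "p \<in> {..<?n}" "q \<in> {..<?n}" for p q
        using none that by auto
    qed auto
    define B where "B = {p \<in> {..<?n}. length (?cs p) \<le> 2 * k}"
    have "card B \<le> card W"
    proof (rule card_inj_on_le)
      show "inj_on ?cs B" using inj by (rule inj_on_subset) (auto simp: B_def)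
      show "?cs ` B \<subseteq> W"
        using crossing_sequence_states[OF assms x] by (auto simp: B_def W_def)
    qed (rule finW)
    moreover have "(2 * k + 1) * (?n - card B) \<le> k * ?n"
    proof -
      have sub: "B \<subseteq> {..<?n}" by (auto simp: B_def)
      have "(2 * k + 1) * (?n - card B) = (\<Sum>p\<in>{..<?n} - B. 2 * k + 1)"
        using card_Diff_subset[OF finite_subset[OF sub] sub] by simp
      also have "\<dots> \<le> (\<Sum>p\<in>{..<?n} - B. length (?cs p))"
        by (intro sum_mono) (auto simp: B_def)
      also have "\<dots> \<le> (\<Sum>p<?n. length (?cs p))"
        by (intro sum_mono2) auto
      also have "\<dots> \<le> t" by (rule total_crossings_le_time)
      finally show ?thesis using t by simp
    qed
    ultimately have "(2 * k + 1) * (?n - card W) \<le> k * ?n"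
      by (meson diff_le_mono2 mult_le_mono2 order_trans)
    then have "(2 * k + 1) * ?n \<le> k * ?n + (2 * k + 1) * card W"
      by (simp add: diff_mult_distrib2 del: mult_Suc_right)
    then show False using long by (simp add: algebra_simps)
  qed
  then show thesis by (rule that[of "(2 * k + 1) * card W"])
qed

section \<open>Linear-time functions lengthen words by a bounded amount\<close>

text \<open>The output ends at the first blank, so the tape determines its length.\<close>

lemma output_length_unique:
  assumes "has_output c y" and "has_output c z"
  shows "length y = length z"
proof -
  have "\<not> length u < length v" if "has_output c u" "has_output c v" for u v
    using that by (cases c) auto
  then show ?thesis using assms by (meson linorder_neqE_nat)
qed

lemma computes_within_run:
  assumes "computes_within \<Sigma> M f T" and "x \<in> lists \<Sigma>"
  obtains t where "t \<le> T (length x)" and "action_at M x t = None" and "has_output (run M x t) (f x)"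
proof -
  obtain t where t: "t \<le> T (length x)" "halted_accepting M (run M x t)" "has_output (run M x t) (f x)"
    using assms unfolding computes_within_def run_def by blast
  moreover have "action_at M x t = None" using t(2) by (cases "run M x t") auto
  ultimately show thesis using that by blast
qed

text \<open>
  Cutting out a segment between equal crossing sequences shortens the input and, as the cut lies
  within the output, the output by the same amount.
\<close>

lemma cut_shortens_output:
  assumes comp: "computes_within \<Sigma> M f T" and x: "x \<in> lists \<Sigma>"
    and pq: "p < q" "q \<le> length x" "q \<le> length (f x)"
    and halt: "action_at M x t = None" and out: "has_output (run M x t) (f x)"
    and eq: "crossing_sequence M x p t = crossing_sequence M x q t"
  shows "length (f (take p x @ drop q x)) + (q - p) = length (f x)"
proof -
  let ?z = "take p x @ drop q x"
  have "?z \<in> lists \<Sigma>" using x by (auto dest: in_set_takeD in_set_dropD)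
  then obtain u where u: "action_at M ?z u = None" "has_output (run M ?z u) (f ?z)"
    using computes_within_run[OF comp] by blast
  have plen: "p \<le> length x" using pq by simp
  note tape = splice_final_tape[OF plen pq(2) halt halt eq u(1)]
  let ?y = "take p (f x) @ drop q (f x)"
  have fx: "tape_at M x t 0 = LeftEnd" "\<And>i. i < length (f x) \<Longrightarrow> tape_at M x t (Suc i) = Letter (f x ! i)"
    "tape_at M x t (Suc (length (f x))) = Blank"
    using out by (cases "run M x t"; simp)+
  have "tape_at M ?z u (Suc i) = Letter (?y ! i)" if "i < length ?y" for i
  proof (cases "i < p")
    case True
    then show ?thesis using tape(1)[of "Suc i"] fx(2)[of i] pq by (simp add: nth_append)
  next
    case False
    then obtain j where "i = p + j" using le_Suc_ex not_less by blast
    then show ?thesis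
      using tape(2)[of j] fx(2)[of "q + j"] that pq by (simp add: nth_append min_def)
  qed
  moreover have "tape_at M ?z u (Suc (length ?y)) = Blank"
    using tape(2)[of "length (f x) - q"] fx(3) pq by (simp add: min_def)
  moreover have "tape_at M ?z u 0 = LeftEnd" using tape(1)[of 0] fx(1) by simp
  ultimately have "has_output (run M ?z u) ?y" by (cases "run M ?z u") simp
  then have "length (f ?z) = length ?y" by (rule output_length_unique[OF u(2)])
  then show ?thesis using pq by simp
qed

text \<open>
  Cutting preserves \<open>length (f x) - length x\<close> and stops only at one of finitely many short
  inputs or once the output is no longer than the input. So the length of the longest output on a
  short input serves as the constant.
\<close>

lemma linear_time_length_increase:
  assumes "pf_linear_time_computable \<Sigma> f"
  obtains C where "\<And>x. x \<in> lists \<Sigma> \<Longrightarrow> length (f x) \<le> length x + C"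
proof -
  obtain M k where M: "pf_tm \<Sigma> M" and comp: "computes_within \<Sigma> M f (\<lambda>n. k * n + k)"
    using assms unfolding pf_linear_time_computable_def by blast
  obtain N where N: "\<And>x t. x \<in> lists \<Sigma> \<Longrightarrow> N \<le> length x \<Longrightarrow> t \<le> k * length x + k \<Longrightarrow>
      \<exists>p q. p < q \<and> q \<le> length x \<and> crossing_sequence M x p t = crossing_sequence M x q t"
    using equal_crossings_exist[OF M] by blast
  have "finite (Letter ` \<Sigma>)" using M unfolding pf_tm_def by (meson finite_subset le_sup_iff)
  then have "finite \<Sigma>" by (rule finite_imageD) (auto simp: inj_on_def)
  then have "finite ((\<lambda>x. length (f x)) ` {x. set x \<subseteq> \<Sigma> \<and> length x \<le> N})"
    by (intro finite_imageI finite_lists_length_le)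
  then obtain C where C: "\<And>x. set x \<subseteq> \<Sigma> \<Longrightarrow> length x \<le> N \<Longrightarrow> length (f x) \<le> C"
    unfolding finite_nat_set_iff_bounded_le by auto
  have "length (f x) \<le> length x + C" if "x \<in> lists \<Sigma>" for x
    using that
  proof (induction x rule: length_induct)
    case (1 x)
    consider "length x \<le> N" | "length (f x) \<le> length x" | "N \<le> length x" "length x \<le> length (f x)"
      by linarith
    then show ?case
    proof cases
      case 1
      then show ?thesis using C[of x] "1.prems" by (simp add: in_lists_conv_set subset_iff trans_le_add2)
    next
      case 3
      obtain t where t: "t \<le> k * length x + k" "action_at M x t = None" "has_output (run M x t) (f x)"
        using computes_within_run[OF comp "1.prems"] by blast
      obtain p q where pq: "p < q" "q \<le> length x" "crossing_sequence M x p t = crossing_sequence M x q t"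
        using N[OF "1.prems" 3(1) t(1)] by blast
      let ?z = "take p x @ drop q x"
      have "?z \<in> lists \<Sigma>" using "1.prems" by (auto dest: in_set_takeD in_set_dropD)
      moreover have "length ?z < length x" using pq by simp
      ultimately have "length (f ?z) \<le> length ?z + C" using "1.IH" by blast
      moreover have "length (f ?z) + (q - p) = length (f x)"
        using cut_shortens_output[OF comp "1.prems" pq(1,2) _ t(2,3) pq(3)] pq(2) 3(2) by simp
      ultimately show ?thesis using pq by simp
    qed simp
  qed
  then show thesis by (rule that)
qed

section \<open>Quasigeodesic normal forms\<close>

context group
begin

lemma foldr_mult_closed: "ws \<in> lists (carrier G) \<Longrightarrow> foldr (\<otimes>) ws \<one> \<in> carrier G"
  by (induction ws) auto

lemma foldr_mult_snoc:
  assumes "ws \<in> lists (carrier G)" and "s \<in> carrier G"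
  shows "foldr (\<otimes>) (ws @ [s]) \<one> = foldr (\<otimes>) ws \<one> \<otimes> s"
  using assms foldr_mult_closed by (induction ws) (auto simp: m_assoc)

text \<open>
  The machines append generators on the right, so the word is read from left to right, starting
  at the representative of the identity.
\<close>

lemma representative_length_le:
  assumes rep: "cayley_pf_linear_time_representation S \<Sigma> L \<psi>"
  obtains B C where "\<And>ws w. ws \<in> lists S \<Longrightarrow> w \<in> L \<Longrightarrow> \<psi> w = foldr (\<otimes>) ws \<one> \<Longrightarrow>
    length w \<le> B + C * length ws"
proof -
  have S: "finite S" "S \<subseteq> carrier G" and L: "L \<subseteq> lists \<Sigma>" and bij: "bij_betw \<psi> L (carrier G)"
    using rep by (auto simp: cayley_pf_linear_time_representation_def semigroup_generators_def)
  have "\<exists>c. \<forall>w\<in>L. \<exists>v\<in>L. \<psi> v = \<psi> w \<otimes> s \<and> length v \<le> length w + c" if "s \<in> S" for s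
  proof -
    have "\<forall>s\<in>S. \<exists>f. pf_linear_time_computable \<Sigma> f \<and> f ` L \<subseteq> L \<and> (\<forall>w\<in>L. \<psi> (f w) = \<psi> w \<otimes> s)"
      using rep unfolding cayley_pf_linear_time_representation_def by (elim conjE)
    from bspec[OF this that] obtain f where f: "pf_linear_time_computable \<Sigma> f" "f ` L \<subseteq> L"
        "\<forall>w\<in>L. \<psi> (f w) = \<psi> w \<otimes> s"
      by (elim exE conjE)
    obtain c where "\<And>x. x \<in> lists \<Sigma> \<Longrightarrow> length (f x) \<le> length x + c"
      using linear_time_length_increase[OF f(1)] by blast
    then have "\<forall>w\<in>L. f w \<in> L \<and> \<psi> (f w) = \<psi> w \<otimes> s \<and> length (f w) \<le> length w + c"
      using f(2,3) L by (simp add: subset_iff image_subset_iff)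
    then show ?thesis by blast
  qed
  then obtain c where c: "\<And>s w. s \<in> S \<Longrightarrow> w \<in> L \<Longrightarrow> \<exists>v\<in>L. \<psi> v = \<psi> w \<otimes> s \<and> length v \<le> length w + c s"
    by metis
  define C where "C = sum c S"
  have cC: "c s \<le> C" if "s \<in> S" for s
    unfolding C_def using S(1) that by (simp add: member_le_sum)
  obtain e where e: "e \<in> L" "\<psi> e = \<one>" using bij by (metis bij_betw_iff_bijections one_closed)
  have "\<exists>w\<in>L. \<psi> w = foldr (\<otimes>) ws \<one> \<and> length w \<le> length e + C * length ws" if "ws \<in> lists S" for ws
    using that
  proof (induction ws rule: rev_induct)
    case Nil
    show ?case using e by auto
  next
    case (snoc s ws)
    then obtain w where w: "w \<in> L" "\<psi> w = foldr (\<otimes>) ws \<one>" "length w \<le> length e + C * length ws"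
      by auto
    have s: "s \<in> S" using snoc.prems by simp
    obtain v where v: "v \<in> L" "\<psi> v = \<psi> w \<otimes> s" "length v \<le> length w + c s"
      using c[OF s w(1)] by blast
    have "foldr (\<otimes>) (ws @ [s]) \<one> = \<psi> v"
      using foldr_mult_snoc[of ws s] v(2) w(2) snoc.prems s S(2)
      by (metis append_in_lists_conv in_mono lists_mono)
    moreover have "length v \<le> length e + C * length (ws @ [s])"
      using v(3) w(3) cC[OF s] by simp
    ultimately show ?case using v(1) by auto
  qed
  moreover have "inj_on \<psi> L" using bij by (rule bij_betw_imp_inj_on)
  ultimately have "length w \<le> length e + C * length ws"
    if "ws \<in> lists S" "w \<in> L" "\<psi> w = foldr (\<otimes>) ws \<one>" for ws w
    using that by (metis inj_onD)
  then show thesis by (rule that)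
qed

lemma geodesic_word:
  assumes "semigroup_generators (A \<union> m_inv G ` A)" and "g \<in> carrier G"
  obtains ws where "ws \<in> lists (A \<union> m_inv G ` A)" and "length ws = word_length A g"
    and "foldr (\<otimes>) ws \<one> = g"
proof -
  have "\<exists>ws\<in>lists (A \<union> m_inv G ` A). g = foldr (\<otimes>) ws \<one>"
    using assms unfolding semigroup_generators_def by (elim conjE) (erule bspec)
  then have "\<exists>n. \<exists>ws\<in>lists (A \<union> m_inv G ` A). length ws = n \<and> foldr (\<otimes>) ws \<one> = g"
    by metis
  then have "\<exists>ws\<in>lists (A \<union> m_inv G ` A). length ws = word_length A g \<and> foldr (\<otimes>) ws \<one> = g"
    unfolding word_length_def by (rule LeastI_ex)
  then show thesis by (elim bexE conjE) (rule that)
qed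

lemma representation_quasigeodesic:
  assumes rep: "cayley_pf_linear_time_representation (A \<union> m_inv G ` A) \<Sigma> L \<psi>"
  shows "quasigeodesic_normal_form A L \<psi>"
proof -
  obtain B C where BC: "\<And>ws w. ws \<in> lists (A \<union> m_inv G ` A) \<Longrightarrow> w \<in> L \<Longrightarrow>
      \<psi> w = foldr (\<otimes>) ws \<one> \<Longrightarrow> length w \<le> B + C * length ws"
    using representative_length_le[OF rep] by blast
  have "real (length w) \<le> real (B + C) * (real (word_length A (\<psi> w)) + 1)" if w: "w \<in> L" for w
  proof -
    have "\<psi> w \<in> carrier G" and "semigroup_generators (A \<union> m_inv G ` A)"
      using rep w by (auto simp: cayley_pf_linear_time_representation_def bij_betw_def)
    then obtain ws where "ws \<in> lists (A \<union> m_inv G ` A)" "length ws = word_length A (\<psi> w)"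
        "foldr (\<otimes>) ws \<one> = \<psi> w"
      using geodesic_word by blast
    then have "length w \<le> B + C * word_length A (\<psi> w)" using BC w by metis
    also have "\<dots> \<le> (B + C) * (word_length A (\<psi> w) + 1)" by (simp add: algebra_simps)
    finally have "real (length w) \<le> real ((B + C) * (word_length A (\<psi> w) + 1))"
      by (simp only: of_nat_le_iff)
    then show ?thesis by (simp add: algebra_simps)
  qed
  then show ?thesis unfolding quasigeodesic_normal_form_def by blast
qed

end

theorem theorem1:
  fixes G :: "('g, 'm) monoid_scheme"
    and A :: "'g set"
    and \<Sigma> :: "'c set"
    and L :: "'c list set"
    and \<psi> :: "'c list \<Rightarrow> 'g"
  assumes "group G"
    and "finite A" and "A \<subseteq> carrier G" and "generate G A = carrier G"
    and "group.cayley_pf_linear_time_representation G (A \<union> m_inv G ` A) \<Sigma> L \<psi>"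
  shows "group.quasigeodesic_normal_form G A L \<psi>"
  using group.representation_quasigeodesic[OF assms(1,5)] .

end
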